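(* (i) Let $c>0$ be a real number and suppose that property $\mathrm{MMS}^*(c)$ (defined in the context) holds. Then for every real $p$ with $0\le p\le 1/3$ and $p<1/c$, statement $\mathrm{B}(p)$ (defined in the context) holds; that is, for every positive integer $m$, every $w\in\mathbb{R}_{>0}^m$ with $\sum_{i=1}^m w_i=1$, and $v\in\{0,1\}^m$ a random vector with i.i.d. Bernoulli$(p)$ coordinates, one has $\mathbb{P}[\langle v,w\rangle\ge p]\ge p$. (ii) In particular, if property $\mathrm{MMS}^*(3+\varepsilon)$ holds for every real $\varepsilon>0$, then $\mathrm{B}(p)$ holds for every real $p$ with $0\le p\le 1/3$.
   Context: For a real number $c>0$, property $\mathrm{MMS}^*(c)$ is the following assertion: for every constant $C>0$ there exists $N$ such that for all integers $n,k\ge N$ with $n\ge ck$, and all real numbers $x_1,\dots,x_n$ such that $\sum_{i=1}^n x_i=0$, at most $C$ of the $x_i$ (counted by index) are nonnegative, and any two negative values $x_i,x_j$ are equal, at least $\binom{n-1}{k-1}$ of the $k$-element subsets $S\subseteq[n]=\{1,\dots,n\}$ satisfy $\sum_{i\in S}x_i\ge 0$. For a real number $p\in[0,1]$, statement $\mathrm{B}(p)$ is the following assertion: for every positive integer $m$, every $w\in\mathbb{R}_{>0}^m$ with $\sum_{i=1}^m w_i=1$, and $v=(v_1,\dots,v_m)\in\{0,1\}^m$ a random vector whose coordinates are independent with $\mathbb{P}[v_i=1]=p$ and $\mathbb{P}[v_i=0]=1-p$, one has $\mathbb{P}[\langle v,w\rangle\ge p]\ge p$, where $\langle v,w\rangle=\sum_{i=1}^m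 w_iv_i$. *)

theory Defs
  imports "HOL-Probability.Probability"
begin

(* If some N works then so does every larger one, so the truncated subtraction at n = 0 or
   k = 0 does not affect the property: N may always be taken positive. *)
definition MMS_star :: "real \<Rightarrow> bool" where
  "MMS_star c \<longleftrightarrow>
    (\<forall>C::real. C > 0 \<longrightarrow>
      (\<exists>N::nat. \<forall>n k :: nat. n \<ge> N \<longrightarrow> k \<ge> N \<longrightarrow> real n \<ge> c * real k \<longrightarrow>
        (\<forall>x :: nat \<Rightarrow> real.
          (\<Sum>i=1..n. x i) = 0 \<longrightarrow>
          real (card {i \<in> {1..n}. x i \<ge> 0}) \<le> C \<longrightarrow>
          (\<forall>i\<in>{1..n}. \<forall>j\<in>{1..n}. x i < 0 \<longrightarrow> x j < 0 \<longrightarrow> x i = x j) \<longrightarrow>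
          card {S. S \<subseteq> {1..n} \<and> card S = k \<and> (\<Sum>i\<in>S. x i) \<ge> 0} \<ge> (n - 1) choose (k - 1))))"

(* Law of a vector with coordinates 1, ..., m i.i.d. Bernoulli(p); True encodes the value 1.
   Only meaningful for p in [0,1]: bernoulli_pmf clamps its parameter to that interval. *)
definition bernoulli_vec :: "nat \<Rightarrow> real \<Rightarrow> (nat \<Rightarrow> bool) pmf" where
  "bernoulli_vec m p = Pi_pmf {1..m} False (\<lambda>_. bernoulli_pmf p)"

definition B :: "real \<Rightarrow> bool" where
  "B p \<longleftrightarrow>
    (\<forall>(m::nat) (w :: nat \<Rightarrow> real). m > 0 \<longrightarrow> (\<forall>i\<in>{1..m}. w i > 0) \<longrightarrow> (\<Sum>i=1..m. w i) = 1 \<longrightarrow>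
      measure_pmf.prob (bernoulli_vec m p) {v. (\<Sum>i=1..m. w i * of_bool (v i)) \<ge> p} \<ge> p)"

end

theory Submission
  imports Defs "HOL-Real_Asymp.Real_Asymp"
begin

text \<open>
  Given weights \<open>w\<close> on \<open>{1..m}\<close>, apply the hypothesis to \<open>x\<^sub>i = w\<^sub>i - 1/n\<close> (with \<open>w\<^sub>i = 0\<close> for
  \<open>i > m\<close>) and \<open>k = \<lceil>pn\<rceil>\<close>: a uniformly random \<open>k\<close>-subset of \<open>{1..n}\<close> has \<open>w\<close>-weight at least
  \<open>k/n \<ge> p\<close> with probability at least \<open>k/n \<ge> p\<close>. As \<open>n\<close> grows, the trace of this subset on
  \<open>{1..m}\<close> converges in law to a set of independent Bernoulli(\<open>p\<close>) elements.
  The endpoint \<open>p = 1/3\<close> is reached from below, because only finitely many weights occur.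
\<close>

section \<open>Bernoulli probabilities as finite sums\<close>

text \<open>The event depends only on the set of coordinates that are \<open>True\<close>. The
  resulting sum is a polynomial in \<open>p\<close> over a finite family of sets, so limits can
  later be taken term by term.\<close>

lemma prob_bernoulli_vec:
  assumes "0 \<le> p" "p \<le> 1"
  shows "measure_pmf.prob (bernoulli_vec m p) {v. (\<Sum>i=1..m. w i * of_bool (v i)) \<ge> (t::real)}
       = (\<Sum>A | A \<subseteq> {1..m} \<and> sum w A \<ge> t. p ^ card A * (1 - p) ^ (m - card A))"
proof -
  let ?F = "{A. A \<subseteq> {1..m} \<and> sum w A \<ge> t}"
  let ?E = "{v. (\<Sum>i=1..m. w i * of_bool (v i)) \<ge> t}"
  let ?ind = "\<lambda>A::nat set. (\<lambda>i. i \<in> A)"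
  have finF: "finite ?F"
    by (rule finite_subset[of _ "Pow {1..m}"]) auto
  have wsum: "(\<Sum>i=1..m. w i * of_bool (i \<in> A)) = sum w A" if "A \<subseteq> {1..m}" for A
  proof -
    have "(\<Sum>i=1..m. w i * of_bool (i \<in> A)) = (\<Sum>i=1..m. if i \<in> A then w i else 0)"
      by (intro sum.cong) auto
    also have "\<dots> = sum w ({1..m} \<inter> A)"
      by (simp add: sum.inter_restrict)
    also have "{1..m} \<inter> A = A"
      using that by blast
    finally show ?thesis .
  qed
  have pmf: "pmf (bernoulli_vec m p) (?ind A) = p ^ card A * (1 - p) ^ (m - card A)"
    if "A \<subseteq> {1..m}" for A
  proof -
    have "pmf (bernoulli_vec m p) (?ind A) = (\<Prod>i\<in>{1..m}. if i \<in> A then p else 1 - p)"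
      unfolding bernoulli_vec_def using that assms
      by (subst pmf_Pi') (auto intro!: prod.cong)
    also have "\<dots> = (\<Prod>i\<in>A. p) * (\<Prod>i\<in>{1..m} - A. 1 - p)"
      using that by (simp add: prod.If_cases Int_absorb1 Diff_eq)
    also have "\<dots> = p ^ card A * (1 - p) ^ (m - card A)"
      using that by (simp add: card_Diff_subset finite_subset)
    finally show ?thesis .
  qed
  \<comment> \<open>The two events differ only by vectors that are \<open>True\<close> somewhere
    outside \<open>{1..m}\<close>. These have mass 0, since \<open>False\<close> is the default
    value of the product law.\<close>
  have "measure_pmf.prob (bernoulli_vec m p) ?E = measure_pmf.prob (bernoulli_vec m p) (?ind ` ?F)"
  proof (rule measure_prob_cong_0)
    fix v assume v: "v \<in> ?E - ?ind ` ?F"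
    have "v = ?ind {i. v i}" by simp
    hence "{i. v i} \<notin> ?F" using v by blast
    hence "\<not> {i. v i} \<subseteq> {1..m}" using v wsum[of "{i. v i}"] by auto
    thus "pmf (bernoulli_vec m p) v = 0"
      unfolding bernoulli_vec_def by (subst pmf_Pi) auto
  next
    fix v assume "v \<in> ?ind ` ?F - ?E"
    thus "pmf (bernoulli_vec m p) v = 0" using wsum by auto
  qed
  also have "\<dots> = (\<Sum>v\<in>?ind ` ?F. pmf (bernoulli_vec m p) v)"
    using finF by (simp add: measure_measure_pmf_finite)
  also have "\<dots> = (\<Sum>A\<in>?F. pmf (bernoulli_vec m p) (?ind A))"
    by (subst sum.reindex) (auto intro!: inj_onI simp: fun_eq_iff)
  also have "\<dots> = (\<Sum>A\<in>?F. p ^ card A * (1 - p) ^ (m - card A))"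
    using pmf by (intro sum.cong) auto
  finally show ?thesis .
qed

section \<open>Counting subsets by their trace\<close>

text \<open>A set \<open>S\<close> splits into its trace \<open>A\<close> on \<open>U\<close> and a
  subset of \<open>V - U\<close> of size \<open>k - card A\<close>. When \<open>card A > k\<close>
  the truncated difference contributes 1 where the true count is 0, which is harmless for an upper
  bound.\<close>

lemma card_subsets_trace_le:
  assumes "finite V" "U \<subseteq> V" "F \<subseteq> Pow U"
  shows "card {S. S \<subseteq> V \<and> card S = k \<and> S \<inter> U \<in> F}
       \<le> (\<Sum>A\<in>F. (card V - card U) choose (k - card A))"
proof -
  let ?T = "\<lambda>A. {T. T \<subseteq> V - U \<and> card T = k - card A}"
  have finU: "finite U" using assms finite_subset by blast
  have finF: "finite F" using assms finU finite_subset by blast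
  have finT: "finite (?T A)" for A
    by (rule finite_subset[of _ "Pow V"]) (use assms in auto)
  have "{S. S \<subseteq> V \<and> card S = k \<and> S \<inter> U \<in> F} \<subseteq> (\<Union>A\<in>F. (\<union>) A ` ?T A)"
  proof
    fix S assume S: "S \<in> {S. S \<subseteq> V \<and> card S = k \<and> S \<inter> U \<in> F}"
    have "card (S - U) = k - card (S \<inter> U)"
      using S finU by (simp add: card_Diff_subset_Int)
    hence "S - U \<in> ?T (S \<inter> U)" using S by auto
    moreover have "S = (S \<inter> U) \<union> (S - U)" by auto
    ultimately show "S \<in> (\<Union>A\<in>F. (\<union>) A ` ?T A)" using S by blast
  qed
  hence "card {S. S \<subseteq> V \<and> card S = k \<and> S \<inter> U \<in> F} \<le> card (\<Union>A\<in>F. (\<union>) A ` ?T A)"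
    using finF finT by (intro card_mono) auto
  also have "\<dots> \<le> (\<Sum>A\<in>F. card ((\<union>) A ` ?T A))"
    using finF by (rule card_UN_le)
  also have "\<dots> \<le> (\<Sum>A\<in>F. card (?T A))"
    using finT by (intro sum_mono card_image_le)
  also have "\<dots> = (\<Sum>A\<in>F. (card V - card U) choose (k - card A))"
    using assms finU by (simp add: n_subsets card_Diff_subset)
  finally show ?thesis .
qed

section \<open>The limit law of the trace\<close>

text \<open>For large \<open>n\<close> the ratio is the probability that a uniformly random subset
  of size \<open>k n\<close> meets \<open>m\<close> given points in a prescribed set of size
  \<open>a\<close>. Each further point multiplies it by a conditional probability, which tends to
  \<open>p\<close> if the point is in the set and to \<open>1 - p\<close> if it is not.\<close>

lemma hypergeometric_tendsto_binomial:
  fixes k :: "nat \<Rightarrow> nat"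
  assumes lim: "(\<lambda>n. real (k n) / real n) \<longlonglongrightarrow> p" and p: "0 < p" "p < 1" and "a \<le> m"
  shows "(\<lambda>n. real ((n - m) choose (k n - a)) / real (n choose k n))
           \<longlonglongrightarrow> p ^ a * (1 - p) ^ (m - a)"
  using \<open>a \<le> m\<close>
proof (induction m arbitrary: a)
  case 0
  \<comment> \<open>This gives \<open>k n < n\<close> for positive \<open>n\<close>, so that the
    binomial in the denominator is nonzero.\<close>
  have "eventually (\<lambda>n. real (k n) / real n < 1) sequentially"
    using lim p by (intro order_tendstoD)
  hence "eventually (\<lambda>n. real (n choose k n) / real (n choose k n) = 1) sequentially"
    using eventually_gt_at_top[of 0] by eventually_elim auto
  thus ?case using 0 by (auto intro: tendsto_eventually)
next
  case (Suc m)
  have inv: "(\<lambda>n. x / real n) \<longlonglongrightarrow> 0" for x :: real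
    by real_asymp
  have ev_pos: "eventually (\<lambda>n. real (Suc m) / real n < real (k n) / real n) sequentially"
  proof -
    have "eventually (\<lambda>n. real (k n) / real n - real (Suc m) / real n > 0) sequentially"
      by (rule order_tendstoD(1)[OF tendsto_diff[OF lim inv]]) (use p in auto)
    thus ?thesis by eventually_elim simp
  qed
  have ev_lt: "eventually (\<lambda>n. real (k n) / real n + real (Suc m) / real n < 1) sequentially"
    by (rule order_tendstoD(2)[OF tendsto_add[OF lim inv]]) (use p in auto)
  \<comment> \<open>In this range none of the natural-number subtractions below is
    truncated.\<close>
  have ev: "eventually (\<lambda>n. Suc m < k n \<and> k n + Suc m < n) sequentially"
    using ev_pos ev_lt eventually_gt_at_top[of 0]
  proof eventually_elim
    case (elim n)
    thus ?case by (auto simp: field_simps simp flip: of_nat_add of_nat_Suc)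
  qed
  have limk: "(\<lambda>n. (real (k n) - real b) / (real n - real m)) \<longlonglongrightarrow> p" for b
  proof (rule Lim_transform_eventually)
    show "(\<lambda>n. (real (k n) / real n - real b / real n) / (1 - real m / real n)) \<longlonglongrightarrow> p"
      using tendsto_divide[OF tendsto_diff[OF lim inv] tendsto_diff[OF tendsto_const inv], of 1]
      by simp
    show "eventually (\<lambda>n. (real (k n) / real n - real b / real n) / (1 - real m / real n)
            = (real (k n) - real b) / (real n - real m)) sequentially"
      using eventually_gt_at_top[of m] by eventually_elim (auto simp: field_simps)
  qed
  show ?case
  proof (cases "a \<le> m")
    case True
    \<comment> \<open>As only \<open>a\<close> matters, the new point may be taken outside the
      prescribed trace; it is then avoided with conditional probability tending to
      \<open>1 - p\<close>.\<close>
    have "(\<lambda>n. (1 - (real (k n) - real a) / (real n - real m)) *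
             (real ((n - m) choose (k n - a)) / real (n choose k n)))
             \<longlonglongrightarrow> (1 - p) * (p ^ a * (1 - p) ^ (m - a))"
      by (intro tendsto_intros limk Suc.IH True)
    hence "(\<lambda>n. (1 - (real (k n) - real a) / (real n - real m)) *
             (real ((n - m) choose (k n - a)) / real (n choose k n)))
             \<longlonglongrightarrow> p ^ a * (1 - p) ^ (Suc m - a)"
      using True by (simp add: Suc_diff_le mult_ac)
    moreover have "eventually (\<lambda>n. (1 - (real (k n) - real a) / (real n - real m)) *
             (real ((n - m) choose (k n - a)) / real (n choose k n))
             = real ((n - Suc m) choose (k n - a)) / real (n choose k n)) sequentially"
      using ev
    proof eventually_elim
      case (elim n)
      have "((n - m) - (k n - a)) * ((n - m) choose (k n - a))
          = (n - m) * ((n - m - 1) choose (k n - a))"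
        by (rule binomial_absorb_comp)
      hence "real ((n - m) - (k n - a)) * real ((n - m) choose (k n - a))
          = real (n - m) * real ((n - Suc m) choose (k n - a))"
        by (simp flip: of_nat_mult)
      moreover have "real ((n - m) - (k n - a)) = (real n - real m) - (real (k n) - real a)"
        using elim True by (simp add: of_nat_diff)
      moreover have "real (n - m) = real n - real m" using elim by simp
      moreover have "real n - real m \<noteq> 0" using elim by simp
      ultimately have "(1 - (real (k n) - real a) / (real n - real m)) *
          real ((n - m) choose (k n - a)) = real ((n - Suc m) choose (k n - a))"
        by (simp add: field_simps)
      thus ?case by (metis times_divide_eq_right)
    qed
    ultimately show ?thesis by (rule Lim_transform_eventually)
  next
    case False
    hence a: "a = Suc m" using Suc.prems by simp
    \<comment> \<open>Here all \<open>Suc m\<close> points are in the trace, so the new factor tends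
      to \<open>p\<close>.\<close>
    have "(\<lambda>n. ((real (k n) - real m) / (real n - real m)) *
             (real ((n - m) choose (k n - m)) / real (n choose k n)))
             \<longlonglongrightarrow> p * (p ^ m * (1 - p) ^ (m - m))"
      by (intro tendsto_intros limk Suc.IH order.refl)
    hence "(\<lambda>n. ((real (k n) - real m) / (real n - real m)) *
             (real ((n - m) choose (k n - m)) / real (n choose k n)))
             \<longlonglongrightarrow> p ^ a * (1 - p) ^ (Suc m - a)"
      by (simp add: a)
    moreover have "eventually (\<lambda>n. ((real (k n) - real m) / (real n - real m)) *
             (real ((n - m) choose (k n - m)) / real (n choose k n))
             = real ((n - Suc m) choose (k n - a)) / real (n choose k n)) sequentially"
      using ev
    proof eventually_elim
      case (elim n)
      have "(k n - m) * ((n - m) choose (k n - m)) = (n - m) * ((n - m - 1) choose (k n - m - 1))"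
        using elim by (intro times_binomial_minus1_eq) auto
      hence "real (k n - m) * real ((n - m) choose (k n - m))
           = real (n - m) * real ((n - Suc m) choose (k n - a))"
        by (simp add: a flip: of_nat_mult)
      moreover have "real (n - m) = real n - real m" "real (k n - m) = real (k n) - real m"
        "real n - real m \<noteq> 0" using elim by (simp_all add: of_nat_diff)
      ultimately have "(real (k n) - real m) / (real n - real m) *
          real ((n - m) choose (k n - m)) = real ((n - Suc m) choose (k n - a))"
        by (simp add: field_simps)
      thus ?case by (metis times_divide_eq_right)
    qed
    ultimately show ?thesis by (rule Lim_transform_eventually)
  qed
qed

section \<open>Transfer from random subsets to Bernoulli vectors\<close>

text \<open>The strict inequality \<open>p < 1 / c\<close> leaves room for rounding
  \<open>p * n\<close> up to an integer: the size condition \<open>n \<ge> c * k\<close> still holds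
  for large \<open>n\<close>.\<close>

lemma MMS_star_imp_B:
  assumes "MMS_star c" "c > 0" "0 < p" "p < 1" "p < 1 / c"
  shows "B p"
  unfolding B_def
proof (intro allI impI)
  fix m :: nat and w :: "nat \<Rightarrow> real"
  assume m: "m > 0" and w: "\<forall>i\<in>{1..m}. w i > 0" and sw: "(\<Sum>i=1..m. w i) = 1"
  define F where "F = {A. A \<subseteq> {1..m} \<and> sum w A \<ge> p}"
  define k where "k = (\<lambda>n. nat \<lceil>p * real n\<rceil>)"
  \<comment> \<open>Rounding up serves twice: for the weight threshold and for the final bound on
    the probability.\<close>
  have k_ge: "p * real n \<le> real (k n)" for n
    using \<open>0 < p\<close> by (simp add: k_def)
  have limk: "(\<lambda>n. real (k n) / real n) \<longlonglongrightarrow> p"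
    unfolding k_def using \<open>0 < p\<close> by real_asymp
  have "real m > 0" using m by simp
  \<comment> \<open>The constant is \<open>m\<close> because only the \<open>m\<close> weighted
    indices can carry nonnegative values.\<close>
  from mp[OF spec[OF assms(1)[unfolded MMS_star_def], of "real m"] this]
  obtain N where N: "\<forall>n k. n \<ge> N \<longrightarrow> k \<ge> N \<longrightarrow> real n \<ge> c * real k \<longrightarrow>
        (\<forall>x :: nat \<Rightarrow> real.
          (\<Sum>i=1..n. x i) = 0 \<longrightarrow>
          real (card {i \<in> {1..n}. x i \<ge> 0}) \<le> real m \<longrightarrow>
          (\<forall>i\<in>{1..n}. \<forall>j\<in>{1..n}. x i < 0 \<longrightarrow> x j < 0 \<longrightarrow> x i = x j) \<longrightarrow>
          card {S. S \<subseteq> {1..n} \<and> card S = k \<and> (\<Sum>i\<in>S. x i) \<ge> 0} \<ge> (n - 1) choose (k - 1))"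
    by (rule exE)
  have k_top: "filterlim k at_top sequentially"
    unfolding k_def using \<open>0 < p\<close> by real_asymp
  have ev_k: "eventually (\<lambda>n. k n \<ge> N) sequentially" "eventually (\<lambda>n. k n > 0) sequentially"
    using k_top unfolding filterlim_at_top by (auto simp: Suc_le_eq dest: spec[of _ "Suc 0"])
  have ev_c: "eventually (\<lambda>n. real (k n) / real n < 1 / c) sequentially"
    and ev_1: "eventually (\<lambda>n. real (k n) / real n < 1) sequentially"
    using order_tendstoD(2)[OF limk] assms by simp_all
  \<comment> \<open>Once every weight exceeds \<open>1 / n\<close>, the negative values are those at
    unweighted indices, and these all equal \<open>- (1 / n)\<close>.\<close>
  have ev_w: "eventually (\<lambda>n. \<forall>i\<in>{1..m}. 1 / real n < w i) sequentially"
  proof (intro eventually_ball_finite ballI)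
    fix i assume "i \<in> {1..m}"
    moreover have "(\<lambda>n. 1 / real n) \<longlonglongrightarrow> 0" by real_asymp
    ultimately show "eventually (\<lambda>n. 1 / real n < w i) sequentially"
      using w by (intro order_tendstoD) auto
  qed simp
  have bound: "eventually (\<lambda>n. p \<le> (\<Sum>A\<in>F. real ((n - m) choose (k n - card A))
                                      / real (n choose k n))) sequentially"
    using ev_k ev_c ev_1 ev_w eventually_ge_at_top[of "max (Suc m) N"]
  proof eventually_elim
    case (elim n)
    define x where "x = (\<lambda>i. (if i \<in> {1..m} then w i else 0) - 1 / real n)"
    have n: "n \<ge> N" "m < n" "0 < n" "m \<le> n" using elim by auto
    have kn: "k n \<le> n" using elim(4) n by simp
    have sum_x: "(\<Sum>i\<in>S. x i) = sum w (S \<inter> {1..m}) - real (card S) / real n"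
      if "finite S" for S
      unfolding x_def sum_subtractf sum.inter_restrict[OF that] by simp
    have x_neg: "x i = - (1 / real n)" if "x i < 0" for i
    proof -
      have "i \<notin> {1..m}"
      proof
        assume i: "i \<in> {1..m}"
        hence "1 / real n < w i" using elim(5) by blast
        with i that show False by (simp add: x_def)
      qed
      thus ?thesis unfolding x_def by (simp only: if_False)
    qed
    have nonneg: "{i \<in> {1..n}. x i \<ge> 0} \<subseteq> {1..m}"
      using n by (auto simp: x_def split: if_splits)
    have "(n - 1) choose (k n - 1)
        \<le> card {S. S \<subseteq> {1..n} \<and> card S = k n \<and> (\<Sum>i\<in>S. x i) \<ge> 0}"
    proof (rule N[rule_format (no_asm)])
      show "c * real (k n) \<le> real n"
        using elim(3) n assms(2) by (simp add: field_simps)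
      have "{1..n} \<inter> {1..m} = {1..m}" using n by auto
      thus "(\<Sum>i=1..n. x i) = 0"
        using n sw by (subst sum_x) auto
      show "real (card {i \<in> {1..n}. x i \<ge> 0}) \<le> real m"
        using card_mono[OF _ nonneg] by simp
      show "\<forall>i\<in>{1..n}. \<forall>j\<in>{1..n}. x i < 0 \<longrightarrow> x j < 0 \<longrightarrow> x i = x j"
        using x_neg by metis
    qed (use n elim in auto)
    \<comment> \<open>A nonnegative sum over \<open>S\<close> forces the weight of its trace to be
      at least \<open>k n / n\<close>, hence at least \<open>p\<close>.\<close>
    also have "\<dots> \<le> card {S. S \<subseteq> {1..n} \<and> card S = k n \<and> S \<inter> {1..m} \<in> F}"
    proof (rule card_mono)
      show "finite {S. S \<subseteq> {1..n} \<and> card S = k n \<and> S \<inter> {1..m} \<in> F}"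
        by (rule finite_subset[of _ "Pow {1..n}"]) auto
      have "p \<le> real (k n) / real n" using k_ge[of n] n by (simp add: field_simps)
      moreover have "(\<Sum>i\<in>S. x i) = sum w (S \<inter> {1..m}) - real (card S) / real n"
        if "S \<subseteq> {1..n}" for S
        using that by (intro sum_x) (rule finite_subset, auto)
      ultimately show "{S. S \<subseteq> {1..n} \<and> card S = k n \<and> (\<Sum>i\<in>S. x i) \<ge> 0}
          \<subseteq> {S. S \<subseteq> {1..n} \<and> card S = k n \<and> S \<inter> {1..m} \<in> F}"
        unfolding F_def by fastforce
    qed
    also have "\<dots> \<le> (\<Sum>A\<in>F. (card {1..n} - card {1..m}) choose (k n - card A))"
      using n by (intro card_subsets_trace_le) (auto simp: F_def)
    finally have le: "real ((n - 1) choose (k n - 1))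
        \<le> (\<Sum>A\<in>F. real ((n - m) choose (k n - card A)))"
      by (simp flip: of_nat_sum)
    \<comment> \<open>This identity turns the guaranteed share of subsets into exactly
      \<open>k n / n\<close>.\<close>
    have "k n * (n choose k n) = n * ((n - 1) choose (k n - 1))"
      using elim by (intro times_binomial_minus1_eq)
    hence eq: "real (k n) * real (n choose k n) = real n * real ((n - 1) choose (k n - 1))"
      by (simp flip: of_nat_mult)
    have pos: "real (n choose k n) > 0" using kn by simp
    have "p \<le> real (k n) / real n" using k_ge[of n] n by (simp add: field_simps)
    also have "\<dots> = real ((n - 1) choose (k n - 1)) / real (n choose k n)"
      using eq n pos by (simp add: field_simps)
    also have "\<dots> \<le> (\<Sum>A\<in>F. real ((n - m) choose (k n - card A))) / real (n choose k n)"
      using le by (rule divide_right_mono) simp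
    finally show ?case by (simp add: sum_divide_distrib)
  qed
  \<comment> \<open>The index family \<open>F\<close> does not depend on \<open>n\<close>, so the
    limit is taken in each summand.\<close>
  have "(\<lambda>n. \<Sum>A\<in>F. real ((n - m) choose (k n - card A)) / real (n choose k n))
      \<longlonglongrightarrow> (\<Sum>A\<in>F. p ^ card A * (1 - p) ^ (m - card A))"
  proof (intro tendsto_sum hypergeometric_tendsto_binomial limk assms)
    fix A assume "A \<in> F"
    thus "card A \<le> m" using card_mono[of "{1..m}" A] by (simp add: F_def)
  qed
  hence "p \<le> (\<Sum>A\<in>F. p ^ card A * (1 - p) ^ (m - card A))"
    using bound by (rule tendsto_lowerbound) simp
  thus "p \<le> measure_pmf.prob (bernoulli_vec m p) {v. (\<Sum>i=1..m. w i * of_bool (v i)) \<ge> p}"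
    using assms by (subst prob_bernoulli_vec) (simp_all add: F_def)
qed

section \<open>Endpoints and conclusion\<close>

lemma B_0: "B 0"
  by (simp add: B_def)

text \<open>For fixed \<open>w\<close> there are finitely many subset sums, so for \<open>q\<close>
  just below \<open>p\<close> none lies in the interval from \<open>q\<close> up to but excluding
  \<open>p\<close>. The thresholds \<open>q\<close> and \<open>p\<close> then select the same sets,
  and continuity of the polynomial \<open>?g\<close> gives the bound at \<open>p\<close>.\<close>

lemma B_left_limit:
  assumes "0 < p" "p \<le> 1" and B: "\<And>q. 0 < q \<Longrightarrow> q < p \<Longrightarrow> B q"
  shows "B p"
  unfolding B_def
proof (intro allI impI)
  fix m :: nat and w :: "nat \<Rightarrow> real"
  assume m: "m > 0" and w: "\<forall>i\<in>{1..m}. w i > 0" and sw: "(\<Sum>i=1..m. w i) = 1"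
  let ?F = "\<lambda>t. {A. A \<subseteq> {1..m} \<and> sum w A \<ge> t}"
  let ?g = "\<lambda>q. \<Sum>A\<in>?F p. q ^ card A * (1 - q) ^ (m - card A)"
  have "eventually (\<lambda>q. \<forall>A\<in>Pow {1..m}. sum w A < p \<longrightarrow> sum w A < q) (at_left p)"
  proof (intro eventually_ball_finite ballI)
    fix A
    show "eventually (\<lambda>q. sum w A < p \<longrightarrow> sum w A < q) (at_left p)"
    proof (cases "sum w A < p")
      case True
      hence "eventually (\<lambda>q. q \<in> {sum w A<..<p}) (at_left p)"
        by (rule eventually_at_left_real)
      thus ?thesis by eventually_elim simp
    qed simp
  qed simp
  moreover have "eventually (\<lambda>q. q \<in> {0<..<p}) (at_left p)"
    using \<open>0 < p\<close> by (rule eventually_at_left_real)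
  ultimately have "eventually (\<lambda>q. q \<le> ?g q) (at_left p)"
  proof eventually_elim
    case (elim q)
    have "sum w A \<ge> q \<longleftrightarrow> sum w A \<ge> p" if "A \<subseteq> {1..m}" for A
    proof
      assume "sum w A \<ge> q"
      moreover have "sum w A < p \<longrightarrow> sum w A < q"
        using elim(1) that by blast
      ultimately show "sum w A \<ge> p" by linarith
    next
      assume "sum w A \<ge> p"
      with elim(2) show "sum w A \<ge> q" by simp
    qed
    hence "?F q = ?F p" by blast
    moreover have "q \<le> measure_pmf.prob (bernoulli_vec m q)
        {v. (\<Sum>i=1..m. w i * of_bool (v i)) \<ge> q}"
      using B[of q] elim(2) m w sw unfolding B_def by simp
    moreover have "0 \<le> q" "q \<le> 1" using elim(2) \<open>p \<le> 1\<close> by auto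
    ultimately show ?case by (simp only: prob_bernoulli_vec)
  qed
  moreover have "(?g \<longlongrightarrow> ?g p) (at_left p)"
    by (intro tendsto_intros)
  ultimately have "p \<le> ?g p"
    by (intro tendsto_le[of "at_left p" ?g "?g p" "\<lambda>q. q"]) simp_all
  thus "p \<le> measure_pmf.prob (bernoulli_vec m p) {v. (\<Sum>i=1..m. w i * of_bool (v i)) \<ge> p}"
    using assms by (subst prob_bernoulli_vec) simp_all
qed

theorem theorem4:
  shows "(\<forall>c::real. c > 0 \<longrightarrow> MMS_star c \<longrightarrow>
            (\<forall>p::real. 0 \<le> p \<longrightarrow> p \<le> 1/3 \<longrightarrow> p < 1/c \<longrightarrow> B p))
       \<and> ((\<forall>\<epsilon>::real. \<epsilon> > 0 \<longrightarrow> MMS_star (3 + \<epsilon>)) \<longrightarrow>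
            (\<forall>p::real. 0 \<le> p \<longrightarrow> p \<le> 1/3 \<longrightarrow> B p))"
proof (intro conjI allI impI)
  fix c p :: real
  assume "c > 0" "MMS_star c" "0 \<le> p" "p \<le> 1/3" "p < 1/c"
  \<comment> \<open>The case \<open>p = 0\<close> is separate because the rounded subset size would
    stay 0 instead of tending to infinity.\<close>
  thus "B p" using MMS_star_imp_B[of c p] B_0 by (cases "p = 0") auto
next
  fix p :: real
  assume MMS: "\<forall>\<epsilon>::real. \<epsilon> > 0 \<longrightarrow> MMS_star (3 + \<epsilon>)" and p: "0 \<le> p" "p \<le> 1/3"
  have B_less: "B q" if q: "0 < q" "q < 1/3" for q
  proof (rule MMS_star_imp_B)
    \<comment> \<open>This puts \<open>3 + \<epsilon>\<close> at the midpoint of 3 and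
      \<open>1 / q\<close>.\<close>
    define \<epsilon> where "\<epsilon> = (1 / q - 3) / 2"
    have "\<epsilon> > 0" "3 + \<epsilon> < 1 / q" using q by (simp_all add: \<epsilon>_def field_simps)
    thus "MMS_star (3 + \<epsilon>)" "3 + \<epsilon> > 0" "q < 1 / (3 + \<epsilon>)"
      using MMS q by (auto simp: field_simps)
  qed (use q in auto)
  show "B p"
  proof (cases "p = 0")
    case False
    \<comment> \<open>For \<open>p = 1/3\<close> no \<open>\<epsilon> > 0\<close> satisfies
      \<open>p < 1 / (3 + \<epsilon>)\<close>, hence the passage to the limit from smaller
      \<open>q\<close>.\<close>
    show ?thesis
      by (rule B_left_limit) (use p False B_less in auto)
  qed (simp add: B_0)
qed

end
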